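(* Let $\mathbf X\in\mathbb R^{n\times d}$ be a matrix of rank $d$. Consider any algorithm given by a probability distribution $P$ over subsets $S\subseteq\{1,\dots,n\}$ (which may depend on $\mathbf X$ but not on the responses) together with a weight function $\mathbf w(S,\mathbf y_S)\in\mathbb R^d$ (which may depend on $\mathbf X$). If there is a set $S$ with $P(S)>0$ and $\operatorname{rank}(\mathbf X_S)<d$, then the expected loss of the algorithm cannot be bounded by a constant times the optimum loss for all response vectors; i.e., there is no constant $C$ such that $$\mathbb E_{S\sim P}\big[L(\mathbf w(S,\mathbf y_S))\big]\le C\,\min_{\mathbf w\in\mathbb R^d}L(\mathbf w)\quad\text{for all }\mathbf y\in\mathbb R^n.$$
   Context: $\mathbf X_S$ and $\mathbf y_S$ are the rows of $\mathbf X$ and the entries of $\mathbf y$ indexed by $S$. $L(\mathbf w)=\|\mathbf X\mathbf w-\mathbf y\|^2$ is the square loss on all $n$ rows. *)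

theory Defs
  imports "HOL-Probability.Probability"
begin

text \<open>
  The rows of a matrix are indexed by a finite type \<open>'n\<close>, so the selected submatrix has
  the index set \<open>S :: 'n set\<close>, which is not a type. It is therefore represented by its set of
  rows; its rank is the library's \<open>rank A = dim (rows A)\<close>, with the rows running over \<open>S\<close>.
\<close>

definition rows_on :: "'n set \<Rightarrow> real^'d^'n \<Rightarrow> (real^'d) set" where
  "rows_on S X = {row i X | i. i \<in> S}"

definition rank_on :: "'n set \<Rightarrow> real^'d^'n \<Rightarrow> nat" where
  "rank_on S X = dim (rows_on S X)"

lemma rank_on_UNIV: "rank_on UNIV X = rank X"
  by (simp add: rank_on_def rows_on_def row_rank_def rows_def)

text \<open>
  The vector of responses indexed by \<open>S\<close>, as a function with domain \<open>S\<close>: outside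
  \<open>S\<close> it is \<open>undefined\<close>, so it carries no information on the other responses.
\<close>

definition entries_on :: "'n set \<Rightarrow> real^'n \<Rightarrow> 'n \<Rightarrow> real" where
  "entries_on S y = restrict (\<lambda>i. y $ i) S"

definition sq_loss :: "real^'d^'n \<Rightarrow> real^'n \<Rightarrow> real^'d \<Rightarrow> real" where
  "sq_loss X y w = (norm (X *v w - y))\<^sup>2"

definition opt_loss :: "real^'d^'n \<Rightarrow> real^'n \<Rightarrow> real" where
  "opt_loss X y = (INF w. sq_loss X y w)"

text \<open>The infimum in \<open>opt_loss\<close> is a minimum:\<close>

lemma opt_loss_attained: "\<exists>w. sq_loss X y w = opt_loss X y \<and> (\<forall>v. opt_loss X y \<le> sq_loss X y v)"
proof -
  let ?R = "range ((*v) X)"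
  have "closed ?R"
    by (intro closed_subspace linear_subspace_image) auto
  then obtain z where z: "z \<in> ?R" "\<forall>u\<in>?R. dist y z \<le> dist y u"
    using closest_point_exists[of ?R y] by blast
  then obtain w where w: "z = X *v w" by blast
  have le: "sq_loss X y w \<le> sq_loss X y v" for v
    unfolding sq_loss_def using z(2) w
    by (intro power_mono) (auto simp: dist_norm norm_minus_commute)
  have "opt_loss X y = sq_loss X y w"
    unfolding opt_loss_def by (rule cInf_eq_minimum) (use le in auto)
  with le show ?thesis by auto
qed

end

theory Submission
  imports Defs
begin

text \<open>
  Choose \<open>v \<noteq> 0\<close> with \<open>X\<^sub>S v = 0\<close>. The responses \<open>0\<close> and \<open>X v\<close> agree on \<open>S\<close> and both have
  optimum loss \<open>0\<close>, so a multiplicative bound would force the single vector predicted from \<open>S\<close>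
  to fit both exactly, although \<open>X v \<noteq> 0\<close> since \<open>X\<close> has full column rank.
\<close>

text \<open>The rows in \<open>S\<close> span a proper subspace, so some nonzero \<open>v\<close> is
  orthogonal to it; entry \<open>i\<close> of \<open>X *v v\<close> is the inner product of row
  \<open>i\<close> with \<open>v\<close>.\<close>

lemma kernel_vector_of_rank_deficient_rows:
  fixes X :: "real^'d^'n"
  assumes "rank_on S X < CARD('d)"
  obtains v where "v \<noteq> 0" "\<And>i. i \<in> S \<Longrightarrow> (X *v v) $ i = 0"
proof -
  obtain v where "v \<noteq> 0" and v: "\<And>u. u \<in> span (rows_on S X) \<Longrightarrow> orthogonal v u"
    using orthogonal_to_subspace_exists[of "rows_on S X"] assms
    by (auto simp: rank_on_def)
  moreover have "(X *v v) $ i = 0" if "i \<in> S" for i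
  proof -
    have "row i X \<in> span (rows_on S X)"
      using that by (auto simp: rows_on_def intro: span_base)
    from v[OF this] show ?thesis
      by (simp add: matrix_vector_mul_component row_def orthogonal_def inner_commute)
  qed
  ultimately show ?thesis using that by blast
qed

lemma opt_loss_mult_vec: "opt_loss X (X *v v) = 0"
  unfolding opt_loss_def by (rule cInf_eq_minimum) (auto simp: sq_loss_def)

lemma perfect_fit_of_expectation_le:
  fixes X :: "real^'d^'n" and P :: "'n set pmf"
  assumes "measure_pmf.expectation P (\<lambda>S. sq_loss X y (f S)) \<le> 0" and "pmf P S > 0"
  shows "X *v f S = y"
proof -
  \<comment> \<open>Integrability holds as \<open>'n set\<close> is finite; without it, integral 0
    could be just the default value.\<close>
  have "integrable (measure_pmf P) (\<lambda>S. sq_loss X y (f S))"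
    by (rule integrable_measure_pmf_finite) simp
  moreover have "measure_pmf.expectation P (\<lambda>S. sq_loss X y (f S)) = 0"
    using assms(1) by (intro antisym Bochner_Integration.integral_nonneg) (simp_all add: sq_loss_def)
  \<comment> \<open>A nonnegative loss of mean 0 vanishes almost surely, hence at every set of
    positive mass.\<close>
  ultimately have "AE S in measure_pmf P. sq_loss X y (f S) = 0"
    by (subst (asm) integral_nonneg_eq_0_iff_AE) (simp_all add: sq_loss_def)
  then show ?thesis
    using assms(2) by (simp add: AE_measure_pmf_iff set_pmf_iff sq_loss_def)
qed

theorem proposition3p4:
  fixes X :: "real^'d^'n"
    and P :: "'n set pmf"
    and w :: "'n set \<Rightarrow> ('n \<Rightarrow> real) \<Rightarrow> real^'d"
  assumes "rank X = CARD('d)"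
    and "\<exists>S. pmf P S > 0 \<and> rank_on S X < CARD('d)"
  shows "\<not> (\<exists>C::real. \<forall>y :: real^'n.
           measure_pmf.expectation P (\<lambda>S. sq_loss X y (w S (entries_on S y))) \<le> C * opt_loss X y)"
proof
  assume "\<exists>C::real. \<forall>y :: real^'n.
           measure_pmf.expectation P (\<lambda>S. sq_loss X y (w S (entries_on S y))) \<le> C * opt_loss X y"
  then obtain C where C: "measure_pmf.expectation P (\<lambda>S. sq_loss X y (w S (entries_on S y)))
      \<le> C * opt_loss X y" for y
    by blast
  obtain S where S: "pmf P S > 0" "rank_on S X < CARD('d)"
    using assms(2) by blast
  then obtain v where v: "v \<noteq> 0" "\<And>i. i \<in> S \<Longrightarrow> (X *v v) $ i = 0"
    using kernel_vector_of_rank_deficient_rows by blast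
  \<comment> \<open>The optimum for \<open>X *v u\<close> is 0, so \<open>C\<close> drops out
    whatever its sign.\<close>
  have fit: "X *v w S (entries_on S (X *v u)) = X *v u" for u
    by (rule perfect_fit_of_expectation_le[OF _ S(1)])
      (use C[of "X *v u"] in \<open>simp add: opt_loss_mult_vec\<close>)
  \<comment> \<open>Both are 0 on \<open>S\<close> and \<open>undefined\<close> elsewhere.\<close>
  have "entries_on S (X *v v) = entries_on S (X *v 0)"
    by (auto simp: entries_on_def restrict_def v(2))
  then have "X *v v = X *v 0"
    using fit by metis
  moreover have "inj ((*v) X)"
    using assms(1) full_rank_injective by blast
  ultimately show False
    using v(1) by (blast dest: injD)
qed

end
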